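(* Let $n\ge1$, $0<\alpha<2$, and let $G\in C^1(\mathbb{R})$ satisfy $G(0)=0$ and $G'(t)\ge c_0>0$ for all $t\in\mathbb{R}$. Let $\lambda\in\mathbb{R}$ and $\Sigma=\{x\in\mathbb{R}^n: x_1<\lambda\}$. For every $K\ge 0$ there exists $\delta_0>0$ such that the following holds for all $0<\delta\le\delta_0$. Let $\Omega\subset\Sigma$ be a bounded region contained in $\{x:\lambda-\delta<x_1<\lambda\}$, and let $c:\Omega\to\mathbb{R}$ be bounded from below by $-K$. Let $u:\mathbb{R}^n\to\mathbb{R}$, $u_\lambda(x)=u(x^\lambda)$, $w=u_\lambda-u$, and suppose that $w\in L_\alpha\cap C^{1,1}_{loc}(\Omega)$ is lower semi-continuous on $\bar\Omega$ and $$\begin{cases}F_\alpha(u_\lambda(x))-F_\alpha(u(x))+c(x)w(x)\ge 0 & \text{in }\Omega,\\ w(x)\ge 0 & \text{in }\Sigma\setminus\Omega,\\ w(x^\lambda)=-w(x) & \text{in }\Sigma.\end{cases}$$ Then $w(x)\ge0$ in $\Omega$. Furthermore, if $w=0$ at some point in $\Omega$, then $w(x)=0$ almost everywhere in $\mathbb{R}^n$. These conclusions hold for unbounded regions $\Omega$ if one further assumes that $\liminf_{|x|\to\infty}w(x)\ge0$.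
   Context: For $x=(x_1,\dots,x_n)\in\mathbb{R}^n$, $x^\lambda=(2\lambda-x_1,x_2,\dots,x_n)$ is the reflection of $x$ about the plane $T_\lambda=\{x_1=\lambda\}$. For $0<\alpha<2$, $$F_\alpha(u(x)) = C_{n,\alpha}\lim_{\epsilon\to0}\int_{\mathbb{R}^n\setminus B_\epsilon(x)}\frac{G(u(x)-u(z))}{|x-z|^{n+\alpha}}\,dz,$$ where $C_{n,\alpha}>0$ is a constant depending only on $n$ and $\alpha$. It is understood that $u\in L_\alpha$ and that $F_\alpha(u(x))$ and $F_\alpha(u_\lambda(x))$ are well defined (the integrals converge for every $\epsilon>0$ and the limits exist and are finite) for $x\in\Omega$. The space $L_\alpha$ is $$L_\alpha=\Big\{u\in L^1_{loc}(\mathbb{R}^n)\ :\ \int_{\mathbb{R}^n}\frac{|u(x)|}{1+|x|^{n+\alpha}}\,dx<\infty\Big\}.$$ Functions are real-valued and defined at every point of $\mathbb{R}^n$. A region is an open set; the limit inferior in the unbounded case is taken over $x\in\Omega$. *)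

theory Defs
  imports "HOL-Analysis.Analysis"
begin

text \<open>The coordinate \<open>k\<close> plays the role of the first coordinate; since \<open>'n\<close> is an
  arbitrary finite index type, the choice of \<open>k\<close> is immaterial.\<close>

definition reflect :: "'n \<Rightarrow> real \<Rightarrow> real ^ 'n \<Rightarrow> real ^ 'n" where
  "reflect k l x = (\<chi> i. if i = k then 2 * l - x $ k else x $ i)"

definition half_space :: "'n \<Rightarrow> real \<Rightarrow> (real ^ 'n) set" where
  "half_space k l = {x. x $ k < l}"

definition F_trunc :: "(real \<Rightarrow> real) \<Rightarrow> real \<Rightarrow> (real ^ 'n \<Rightarrow> real) \<Rightarrow> real ^ 'n \<Rightarrow> real \<Rightarrow> real" where
  "F_trunc G \<alpha> u x \<epsilon> =
     (LINT z:(- ball x \<epsilon>)|lebesgue. G (u x - u z) / norm (x - z) powr (real CARD('n) + \<alpha>))"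

text \<open>\<open>Lim\<close> is a meaningful value only when the limit exists, so \<open>F_op\<close> is to be used
  together with \<open>F_defined\<close>.\<close>

definition F_defined :: "(real \<Rightarrow> real) \<Rightarrow> real \<Rightarrow> (real ^ 'n \<Rightarrow> real) \<Rightarrow> real ^ 'n \<Rightarrow> bool" where
  "F_defined G \<alpha> u x \<longleftrightarrow>
     (\<forall>\<epsilon>>0. set_integrable lebesgue (- ball x \<epsilon>)
        (\<lambda>z. G (u x - u z) / norm (x - z) powr (real CARD('n) + \<alpha>))) \<and>
     (\<exists>L. (F_trunc G \<alpha> u x \<longlongrightarrow> L) (at_right 0))"

definition F_op :: "real \<Rightarrow> (real \<Rightarrow> real) \<Rightarrow> real \<Rightarrow> (real ^ 'n \<Rightarrow> real) \<Rightarrow> real ^ 'n \<Rightarrow> real" where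
  "F_op C G \<alpha> u x = C * Lim (at_right 0) (F_trunc G \<alpha> u x)"

definition locally_integrable :: "(real ^ 'n \<Rightarrow> real) \<Rightarrow> bool" where
  "locally_integrable u \<longleftrightarrow> (\<forall>K. compact K \<longrightarrow> set_integrable lebesgue K u)"

definition L_space :: "real \<Rightarrow> (real ^ 'n \<Rightarrow> real) set" where
  "L_space \<alpha> = {u. locally_integrable u \<and>
     integrable lebesgue (\<lambda>x. \<bar>u x\<bar> / (1 + norm x powr (real CARD('n) + \<alpha>)))}"

text \<open>On compact sets, local Lipschitz continuity and Lipschitz continuity of the gradient
  agree, so it does not matter that the compact sets below need not be convex.\<close>

definition C11_loc :: "(real ^ 'n) set \<Rightarrow> (real ^ 'n \<Rightarrow> real) set" where
  "C11_loc S = {f. \<exists>g. (\<forall>x\<in>S. GDERIV f x :> g x) \<and>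
     (\<forall>K. compact K \<and> K \<subseteq> S \<longrightarrow> (\<exists>L. L-lipschitz_on K g))}"

definition lsc_on :: "(real ^ 'n) set \<Rightarrow> (real ^ 'n \<Rightarrow> real) \<Rightarrow> bool" where
  "lsc_on S f \<longleftrightarrow> (\<forall>x\<in>S. \<forall>a < f x. \<forall>\<^sub>F y in at x within S. a < f y)"

end

theory Submission
  imports Defs
begin

text \<open>At a point \<open>x\<close> where \<open>w\<close> attains a nonpositive minimum over the half space, adding the
  values of the integrand of \<open>F\<^sub>\<alpha>(u\<^sub>\<lambda>(x)) - F\<^sub>\<alpha>(u(x))\<close> at a point and at its reflection gives a
  nonpositive quantity, because \<open>G\<close> is increasing and the kernel is larger on the side of \<open>x\<close>.
  If \<open>w x < 0\<close>, this sum is at most \<open>2 c\<^sub>0 w x\<close> times the kernel; on a ball of radius \<open>\<delta>\<close> whose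
  reflection is at distance at most \<open>5\<delta>\<close> from \<open>x\<close> it contributes a multiple of
  \<open>w x / \<delta>\<^sup>\<alpha>\<close>, which beats \<open>c x * w x\<close> when \<open>\<delta>\<close> is small. If \<open>w x = 0\<close>, the integral of the
  nonpositive sums is nonnegative, so they vanish almost everywhere, and this forces \<open>w = 0\<close>.\<close>

section \<open>Reflection in the plane: distances and Lebesgue measure\<close>

lemma reflect_nth: "reflect k l x $ i = (if i = k then 2 * l - x $ k else x $ i)"
  by (simp add: reflect_def)

lemma reflect_reflect [simp]: "reflect k l (reflect k l x) = x"
  by (simp add: vec_eq_iff reflect_nth)

lemma reflect_conv_axis: "reflect k l x = x + (2 * (l - x $ k)) *\<^sub>R axis k 1"
  by (simp add: vec_eq_iff reflect_nth axis_def)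

lemma norm_reflect_diff [simp]: "norm (reflect k l x - reflect k l y) = norm (x - y)"
proof -
  have "(\<chi> i. (reflect k l x - reflect k l y) $ i) = (\<chi> i. if i = k then - (x - y) $ i else (x - y) $ i)"
    by (simp add: vec_eq_iff reflect_nth)
  then show ?thesis
    by (auto simp: norm_vec_def L2_set_def reflect_nth power2_commute intro!: sum.cong)
qed

text \<open>The vector \<open>x - reflect k l y\<close> is \<open>x - y\<close> shifted along
  \<open>axis k 1\<close>, and expanding the square leaves the product of the signed distances of
  \<open>x\<close> and \<open>y\<close> from the plane. Its sign tells which of \<open>y\<close> and
  its mirror image is closer to \<open>x\<close>.\<close>

lemma norm_diff_reflect_sq:
  "(norm (x - reflect k l y))\<^sup>2 = (norm (x - y))\<^sup>2 + 4 * (l - x $ k) * (l - y $ k)"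
proof -
  have eq: "x - reflect k l y = (x - y) - (2 * (l - y $ k)) *\<^sub>R axis k 1"
    by (simp add: reflect_conv_axis)
  show ?thesis
    unfolding eq power2_norm_eq_inner
    by (simp add: inner_diff_left inner_diff_right inner_axis inner_commute algebra_simps)
qed

lemma norm_diff_less_reflect:
  assumes "x $ k < l" "y $ k < l"
  shows "norm (x - y) < norm (x - reflect k l y)"
proof -
  have "0 < 4 * (l - x $ k) * (l - y $ k)"
    using assms by simp
  then have "(norm (x - y))\<^sup>2 < (norm (x - reflect k l y))\<^sup>2"
    unfolding norm_diff_reflect_sq by linarith
  then show ?thesis
    by (rule power2_less_imp_less) simp
qed

text \<open>The reflection is a translation composed with a diagonal map with entry
  \<open>- 1\<close> at \<open>axis k 1\<close> and \<open>1\<close> at the other basis vectors. The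
  absolute determinant is 1, so the change of variables for such affine maps has density 1.\<close>

lemma lebesgue_reflect:
  fixes k :: "'n::finite"
  shows "lebesgue = distr lebesgue lebesgue (reflect k l :: real ^ 'n \<Rightarrow> real ^ 'n)"
    and "(reflect k l :: real ^ 'n \<Rightarrow> real ^ 'n) \<in> lebesgue \<rightarrow>\<^sub>M lebesgue"
proof -
  let ?a = "axis k 1 :: real ^ 'n"
  define c where "c = (\<lambda>j::real ^ 'n. if j = ?a then - 1 else (1::real))"
  have a: "?a \<in> Basis"
    by (simp add: axis_in_Basis_iff)
  have "(\<Sum>j\<in>Basis. (c j * (x \<bullet> j)) *\<^sub>R j) = x - (2 * x $ k) *\<^sub>R ?a" for x
  proof -
    have "(\<Sum>j\<in>Basis. (c j * (x \<bullet> j)) *\<^sub>R j)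
        = (\<Sum>j\<in>Basis. (x \<bullet> j) *\<^sub>R j - (if j = ?a then (2 * (x \<bullet> ?a)) *\<^sub>R ?a else 0))"
      by (intro sum.cong refl) (auto simp: c_def scaleR_2 scaleR_left_diff_distrib
          simp flip: scaleR_left_distrib scaleR_minus_left scaleR_left_diff_distrib)
    then show ?thesis
      using a by (simp add: sum_subtractf euclidean_representation inner_axis)
  qed
  then have T: "reflect k l = (\<lambda>x. (2 * l) *\<^sub>R ?a + (\<Sum>j\<in>Basis. (c j * (x \<bullet> j)) *\<^sub>R j))"
    by (simp add: fun_eq_iff reflect_conv_axis algebra_simps)
  have c: "\<And>j. c j \<noteq> 0" "(\<Prod>j\<in>Basis. \<bar>c j\<bar>) = 1"
    by (auto simp: c_def if_distrib cong: if_cong)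
  show "lebesgue = distr lebesgue lebesgue (reflect k l :: real ^ 'n \<Rightarrow> real ^ 'n)"
    using lebesgue_affine_euclidean[of c "(2 * l) *\<^sub>R ?a"] c unfolding T[symmetric]
    by (simp add: density_1)
  show "(reflect k l :: real ^ 'n \<Rightarrow> real ^ 'n) \<in> lebesgue \<rightarrow>\<^sub>M lebesgue"
    using lebesgue_affine_measurable[of c "(2 * l) *\<^sub>R ?a"] c unfolding T by simp
qed

lemma integrable_reflect:
  fixes f :: "real ^ 'n::finite \<Rightarrow> real"
  assumes "integrable lebesgue f"
  shows "integrable lebesgue (\<lambda>x. f (reflect k l x))"
  using assms by (subst (asm) lebesgue_reflect(1)[of k l]) (rule integrable_distr[OF lebesgue_reflect(2)])

lemma integral_reflect:
  fixes f :: "real ^ 'n::finite \<Rightarrow> real"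
  assumes "f \<in> borel_measurable lebesgue"
  shows "(LINT x|lebesgue. f (reflect k l x)) = (LINT x|lebesgue. f x)"
proof -
  have "(LINT x|lebesgue. f (reflect k l x)) = (LINT x|distr lebesgue lebesgue (reflect k l). f x)"
    by (rule integral_distr[symmetric, OF lebesgue_reflect(2) assms])
  then show ?thesis
    by (simp flip: lebesgue_reflect(1))
qed

lemma sets_lebesgue_reflect:
  fixes A :: "(real ^ 'n::finite) set"
  assumes "A \<in> sets lebesgue"
  shows "{x. reflect k l x \<in> A} \<in> sets lebesgue"
  using measurable_sets[OF lebesgue_reflect(2) assms] by (simp add: vimage_def)

section \<open>Strong monotonicity of \<open>G\<close> and minima of semicontinuous
  functions\<close>

text \<open>The bound on \<open>deriv G\<close> enters all later estimates in this integrated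
  form.\<close>

lemma mean_value_lower:
  fixes G :: "real \<Rightarrow> real"
  assumes "G C1_differentiable_on UNIV" "\<And>t. c0 \<le> deriv G t" "a \<le> b"
  shows "c0 * (b - a) \<le> G b - G a"
proof (cases "a = b")
  case False
  have der: "(G has_real_derivative deriv G t) (at t)" for t
  proof -
    obtain D where "(G has_real_derivative D t) (at t)"
      using assms(1) unfolding C1_differentiable_on_def
      by (auto simp: has_real_derivative_iff_has_vector_derivative)
    then show ?thesis
      by (metis DERIV_imp_deriv)
  qed
  from False assms(3) have "a < b"
    by simp
  then obtain t where "G b - G a = (b - a) * deriv G t"
    using MVT2[of a b G "deriv G"] der by blast
  then show ?thesis
    using mult_left_mono[OF assms(2)[of t], of "b - a"] assms(3) by (simp add: mult.commute)
qed simp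

text \<open>Without a minimum, each \<open>x\<close> in \<open>K\<close> has a better point
  \<open>g x\<close>, and lower semicontinuity keeps \<open>f\<close> above \<open>f (g x)\<close>
  near \<open>x\<close>. In a finite subcover by such neighbourhoods, choose the index
  \<open>x\<close> with the least \<open>f (g x)\<close>: the point \<open>g x\<close> lies in some
  \<open>U z\<close>, whence \<open>f (g z) < f (g x)\<close>, a contradiction.\<close>

lemma lsc_on_attains_inf:
  assumes lsc: "lsc_on S f" and "compact K" "K \<subseteq> S" "K \<noteq> {}"
  obtains x where "x \<in> K" "\<And>y. y \<in> K \<Longrightarrow> f x \<le> f y"
proof (rule ccontr)
  assume "\<not> thesis"
  with that have "\<forall>x\<in>K. \<exists>y\<in>K. f y < f x"
    by (meson not_le)
  then obtain g where g: "\<And>x. x \<in> K \<Longrightarrow> g x \<in> K \<and> f (g x) < f x"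
    by metis
  have "\<exists>U. open U \<and> x \<in> U \<and> (\<forall>y\<in>U \<inter> S. f (g x) < f y)" if "x \<in> K" for x
  proof -
    have "\<forall>\<^sub>F y in at x within S. f (g x) < f y"
      using lsc g[OF that] that \<open>K \<subseteq> S\<close> unfolding lsc_on_def by blast
    then obtain U where "open U" "x \<in> U" "\<forall>y\<in>U. y \<noteq> x \<longrightarrow> y \<in> S \<longrightarrow> f (g x) < f y"
      unfolding eventually_at_topological by blast
    \<comment> \<open>The filter is punctured; at \<open>x\<close> itself the bound is the choice of
      \<open>g x\<close>.\<close>
    then show ?thesis
      using g[OF that] by (metis IntE)
  qed
  then obtain U where U: "\<And>x. x \<in> K \<Longrightarrow> open (U x) \<and> x \<in> U x \<and> (\<forall>y\<in>U x \<inter> S. f (g x) < f y)"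
    by metis
  obtain F where F: "F \<subseteq> K" "finite F" "K \<subseteq> (\<Union>x\<in>F. U x)"
    using compactE_image[OF \<open>compact K\<close>, of K U] U by blast
  with \<open>K \<noteq> {}\<close> have "F \<noteq> {}"
    by auto
  with F(2) obtain x where x: "x \<in> F" "\<And>y. y \<in> F \<Longrightarrow> f (g x) \<le> f (g y)"
    using arg_min_if_finite(1)[of F "f \<circ> g"] arg_min_least[of F _ "f \<circ> g"] by auto
  then have "g x \<in> K"
    using F(1) g by blast
  then obtain z where "z \<in> F" "g x \<in> U z"
    using F(3) by blast
  then have "f (g z) < f (g x)"
    using U F(1) \<open>g x \<in> K\<close> \<open>K \<subseteq> S\<close> by blast
  with x(2)[OF \<open>z \<in> F\<close>] show False
    by simp
qed

section \<open>Pairing a point with its reflection at a nonpositive minimum\<close>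

text \<open>The difference of the integrands of the operator for \<open>v\<close> and for
  \<open>u\<close> at \<open>x\<close>; \<open>p\<close> stands for n + \<alpha>.\<close>

definition increment_quotient ::
    "(real \<Rightarrow> real) \<Rightarrow> real \<Rightarrow> (real ^ 'n \<Rightarrow> real) \<Rightarrow> (real ^ 'n \<Rightarrow> real) \<Rightarrow> real ^ 'n \<Rightarrow> real ^ 'n \<Rightarrow> real"
  where "increment_quotient G p u v x z = (G (v x - v z) - G (u x - u z)) / norm (x - z) powr p"

context
  fixes G :: "real \<Rightarrow> real" and c0 p l :: real and k :: "'n::finite"
    and u v :: "real ^ 'n \<Rightarrow> real" and x :: "real ^ 'n"
  assumes G_incr: "\<And>a b. a \<le> b \<Longrightarrow> c0 * (b - a) \<le> G b - G a"
    and c0: "0 < c0" and p: "0 < p"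
    and v: "v = (\<lambda>y. u (reflect k l y))"
    and xl: "x $ k < l"
    and min: "\<And>y. y $ k < l \<Longrightarrow> v x - u x \<le> v y - u y"
    and nonpos: "v x - u x \<le> 0"
begin

private abbreviation (input) h :: "real ^ 'n \<Rightarrow> real" where
  "h \<equiv> increment_quotient G p u v x"

lemma reflected_values: "v (reflect k l y) = u y" "u (reflect k l y) = v y"
  by (simp_all add: v)

lemma increment_quotient_reflect:
  "h (reflect k l z) = (G (v x - u z) - G (u x - v z)) / norm (x - reflect k l z) powr p"
  by (simp add: increment_quotient_def reflected_values)

text \<open>The arguments of \<open>G\<close> differ by the excess of \<open>v - u\<close> at
  \<open>y\<close> over its minimum.\<close>

lemma increment_le:
  assumes "y $ k < l"
  shows "G (v x - v y) - G (u x - u y) \<le> - c0 * ((v y - u y) - (v x - u x))"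
  using G_incr[of "v x - v y" "u x - u y"] min[OF assms] by (simp add: algebra_simps)

lemma increment_nonpos:
  assumes "y $ k < l"
  shows "G (v x - v y) - G (u x - u y) \<le> 0"
proof -
  have "0 \<le> c0 * ((v y - u y) - (v x - u x))"
    using min[OF assms] c0 by simp
  with increment_le[OF assms] show ?thesis
    by linarith
qed

lemma powr_norm_less:
  assumes "y $ k < l"
  shows "norm (x - y) powr p < norm (x - reflect k l y) powr p"
  using norm_diff_less_reflect[OF xl assms] p by (simp add: powr_less_mono2)

text \<open>The numerator at \<open>y\<close> is nonpositive, so passing to the larger denominator
  of the reflected point only raises the quotient. Over this common denominator the four values of
  \<open>G\<close> regroup into two differences with arguments \<open>u x - v x\<close> apart, and
  each gives \<open>c0 * (v x - u x)\<close>.\<close>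

lemma increment_quotient_pair_le:
  assumes y: "y $ k < l" "y \<noteq> x"
  shows "h y + h (reflect k l y)
    \<le> 2 * c0 * (v x - u x) / norm (x - reflect k l y) powr p"
proof -
  let ?N = "norm (x - reflect k l y) powr p" and ?A = "G (v x - v y) - G (u x - u y)"
  have pos: "0 < norm (x - y) powr p"
    using y by simp
  then have pos': "0 < ?N"
    using powr_norm_less[OF y(1)] by linarith
  have "h y \<le> ?A / ?N"
    unfolding increment_quotient_def
    by (rule divide_left_mono_neg[OF _ increment_nonpos[OF y(1)]])
      (use mult_pos_pos[OF pos pos'] powr_norm_less[OF y(1)] in auto)
  then have "h y + h (reflect k l y)
      \<le> (?A + (G (v x - u y) - G (u x - v y))) / ?N"
    by (simp add: increment_quotient_reflect add_divide_distrib)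
  also have "\<dots> \<le> 2 * c0 * (v x - u x) / ?N"
    by (rule divide_right_mono)
      (use G_incr[of "v x - v y" "u x - v y"] G_incr[of "v x - u y" "u x - u y"] nonpos
        in \<open>auto simp: algebra_simps\<close>)
  finally show ?thesis .
qed

text \<open>The sum is invariant under reflection, so the half space case settles the other side; on
  the plane \<open>v\<close> and \<open>u\<close> agree and monotonicity of \<open>G\<close>
  suffices.\<close>

lemma increment_quotient_pair_nonpos:
  assumes "y \<noteq> x" "y \<noteq> reflect k l x"
  shows "h y + h (reflect k l y) \<le> 0"
proof -
  have *: "h z + h (reflect k l z) \<le> 0" if "z $ k < l" "z \<noteq> x" for z
  proof -
    have "2 * c0 * (v x - u x) / norm (x - reflect k l z) powr p \<le> 0"
      using nonpos c0 by (intro divide_nonpos_nonneg mult_nonneg_nonpos) auto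
    with increment_quotient_pair_le[OF that] show ?thesis
      by linarith
  qed
  consider "y $ k < l" | "l < y $ k" | "y $ k = l"
    by linarith
  then show ?thesis
  proof cases
    case 1
    with * assms show ?thesis by blast
  next
    case 2
    then have "reflect k l y $ k < l" "reflect k l y \<noteq> x"
      using assms by (auto simp: reflect_nth)
    with *[of "reflect k l y"] show ?thesis
      by (simp add: add.commute)
  next
    case 3
    then have eq: "reflect k l y = y"
      by (simp add: reflect_conv_axis)
    then have "v y = u y"
      by (simp add: v)
    moreover have "G (v x - u y) \<le> G (u x - u y)"
    proof -
      have "0 \<le> c0 * ((u x - u y) - (v x - u y))"
        using nonpos c0 by simp
      with G_incr[of "v x - u y" "u x - u y"] nonpos show ?thesis
        by linarith
    qed
    ultimately have "h y \<le> 0"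
      unfolding increment_quotient_def by (simp add: divide_nonpos_nonneg)
    with eq show ?thesis
      by simp
  qed
qed

text \<open>Needed for \<open>y\<close> in the removed ball: its mirror image stays in the domain of
  integration without a partner, so its term must have the right sign alone.\<close>

lemma increment_quotient_reflect_nonpos:
  assumes "(v x - u x) + (v y - u y) \<le> 0"
  shows "h (reflect k l y) \<le> 0"
proof -
  have "0 \<le> c0 * ((u x - v y) - (v x - u y))"
    using assms c0 by simp
  then have "G (v x - u y) - G (u x - v y) \<le> 0"
    using G_incr[of "v x - u y" "u x - v y"] assms by linarith
  then show ?thesis
    unfolding increment_quotient_reflect by (simp add: divide_nonpos_nonneg)
qed

text \<open>When \<open>v x = u x\<close> the two numerators are opposite, so the sum is one
  numerator times a nonzero difference of kernels. A vanishing numerator forces \<open>v - u\<close>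
  down to its minimum value 0.\<close>

lemma increment_quotient_pair_eq_0_imp:
  assumes eq: "h y + h (reflect k l y) = 0"
    and y: "y \<noteq> x" "y \<noteq> reflect k l x" and x0: "v x = u x"
  shows "v y = u y"
proof -
  have *: "v z = u z"
    if z: "z $ k < l" "z \<noteq> x" and eq: "h z + h (reflect k l z) = 0" for z
  proof -
    let ?M = "norm (x - z) powr p" and ?N = "norm (x - reflect k l z) powr p"
    let ?A = "G (v x - v z) - G (u x - u z)"
    have M: "0 < ?M" "?M < ?N"
      using powr_norm_less[OF z(1)] z by auto
    have "?A / ?M + (- ?A) / ?N = 0"
      using eq unfolding increment_quotient_reflect unfolding increment_quotient_def x0 by simp
    then have "?A * (inverse ?M - inverse ?N) = 0"
      by (simp add: divide_inverse algebra_simps)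
    moreover have "inverse ?M - inverse ?N \<noteq> 0"
      using M by simp
    ultimately have "?A = 0"
      by simp
    then have "c0 * ((v z - u z) - (v x - u x)) \<le> 0"
      using increment_le[OF z(1)] by simp
    then have "v z - u z \<le> 0"
      using c0 by (simp add: x0 mult_le_0_iff)
    then show ?thesis
      using min[OF z(1)] x0 by simp
  qed
  consider "y $ k < l" | "l < y $ k" | "y $ k = l"
    by linarith
  then show ?thesis
  proof cases
    case 1
    with * assms show ?thesis by blast
  next
    case 2
    then have "reflect k l y $ k < l" "reflect k l y \<noteq> x"
      using y by (auto simp: reflect_nth)
    with *[of "reflect k l y"] eq show ?thesis
      by (simp add: add.commute reflected_values)
  next
    case 3
    then have "reflect k l y = y"
      by (simp add: reflect_conv_axis)
    then show ?thesis
      by (simp add: v)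
  qed
qed

lemma reflect_notin_ball:
  assumes "y $ k \<le> l" "\<epsilon> \<le> l - x $ k"
  shows "reflect k l y \<notin> ball x \<epsilon>"
proof -
  have "\<epsilon> \<le> \<bar>(reflect k l y - x) $ k\<bar>"
    using assms by (simp add: reflect_nth)
  also have "\<dots> \<le> dist x (reflect k l y)"
    by (metis component_le_norm_cart dist_commute dist_norm)
  finally show ?thesis
    by simp
qed

section \<open>Integral consequences of the pairing\<close>

text \<open>Twice the integral is the integral of the pair sums, which are nonpositive everywhere
  and at most \<open>b\<close> on the ball \<open>S\<close> and its mirror image. The resulting
  bound is independent of \<open>\<epsilon>\<close>, so it survives the limit.\<close>

lemma integral_increment_quotient_le:
  assumes \<delta>: "l - x $ k < \<delta>"
    and \<epsilon>: "0 < \<epsilon>" "\<epsilon> \<le> l - x $ k"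
    and near: "\<And>y. y \<in> ball x \<epsilon> \<Longrightarrow> (v x - u x) + (v y - u y) \<le> 0"
    and int: "set_integrable lebesgue (- ball x \<epsilon>) h"
  shows "(LINT z:- ball x \<epsilon>|lebesgue. h z)
    \<le> 2 * c0 * (v x - u x) / (5 * \<delta>) powr p * (\<delta> ^ CARD('n) * measure lborel (ball (0 :: real ^ 'n) 1))"
proof -
  let ?R = "reflect k l"
  define g where "g y = indicat_real (- ball x \<epsilon>) y *\<^sub>R h y" for y
  \<comment> \<open>Moving the centre by \<open>2 * \<delta>\<close> away from the plane puts
    \<open>S\<close> inside the half space and farther than \<open>\<delta>\<close> from
    \<open>x\<close>, hence off the removed ball. Points of \<open>S\<close> are within
    \<open>3 * \<delta>\<close> of \<open>x\<close>, and \<open>x\<close> is within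
    \<open>2 * \<delta>\<close> of its own reflection, which gives the \<open>5 * \<delta>\<close>
    in \<open>b\<close>.\<close>
  define S where "S = ball (x - (2 * \<delta>) *\<^sub>R axis k 1) \<delta>"
  define b where "b = 2 * c0 * (v x - u x) / (5 * \<delta>) powr p"
  have "0 < \<delta>"
    using \<delta> xl by linarith
  have b: "b \<le> 0"
    unfolding b_def using nonpos c0 by (intro divide_nonpos_nonneg mult_nonneg_nonpos) auto
  have S1: "y $ k < l" "\<epsilon> \<le> norm (x - y)" "norm (x - ?R y) \<le> 5 * \<delta>" if "y \<in> S" for y
  proof -
    let ?q = "x - (2 * \<delta>) *\<^sub>R axis k 1 :: real ^ 'n"
    have yq: "norm (?q - y) < \<delta>"
      using that by (simp add: S_def dist_norm)
    have "\<bar>(?q - y) $ k\<bar> < \<delta>"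
      using component_le_norm_cart[of "?q - y" k] yq by linarith
    then have yk: "\<bar>x $ k - 2 * \<delta> - y $ k\<bar> < \<delta>"
      by simp
    then show "y $ k < l"
      using xl by linarith
    have "x $ k - y $ k \<le> norm (x - y)"
      using component_le_norm_cart[of "x - y" k] by simp
    with yk \<delta> \<epsilon> show "\<epsilon> \<le> norm (x - y)"
      by linarith
    have "norm (x - y) \<le> norm (?q - y) + norm ((2 * \<delta>) *\<^sub>R axis k 1 :: real ^ 'n)"
      using norm_triangle_ineq[of "?q - y" "(2 * \<delta>) *\<^sub>R axis k 1"] by simp
    then have 1: "norm (x - y) \<le> 3 * \<delta>"
      using yq \<open>0 < \<delta>\<close> by (simp add: norm_axis_1)
    have "norm (x - ?R x) = norm ((2 * (l - x $ k)) *\<^sub>R axis k 1 :: real ^ 'n)"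
      by (simp add: reflect_conv_axis)
    then have "norm (x - ?R x) \<le> 2 * \<delta>"
      using \<delta> xl by (simp add: norm_axis_1)
    with 1 norm_triangle_ineq[of "x - ?R x" "?R x - ?R y"] show "norm (x - ?R y) \<le> 5 * \<delta>"
      by simp
  qed
  have half: "g y + g (?R y) \<le> b * (indicat_real S y + indicat_real S (?R y))"
    if y: "y $ k < l" for y
  proof -
    have "?R y \<notin> S"
      using S1(1)[of "?R y"] y by (auto simp: reflect_nth)
    moreover have "g (?R y) = h (?R y)"
      using reflect_notin_ball[of y \<epsilon>] y \<epsilon> by (simp add: g_def)
    \<comment> \<open>Three cases: in the removed ball only the reflected term is left, on
      \<open>S\<close> the quantitative bound applies, and elsewhere the sign is enough.\<close>
    moreover have "g y + h (?R y) \<le> b * indicat_real S y"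
    proof (cases "y \<in> ball x \<epsilon>")
      case True
      then have "y \<notin> S"
        using S1(2)[of y] by (auto simp: dist_norm)
      with True increment_quotient_reflect_nonpos[OF near[OF True]] show ?thesis
        by (simp add: g_def)
    next
      case False
      then have "y \<noteq> x" and gy: "g y = h y"
        using \<epsilon> by (auto simp: g_def)
      show ?thesis
      proof (cases "y \<in> S")
        case True
        have "norm (x - ?R y) powr p \<le> (5 * \<delta>) powr p"
          using S1(3)[OF True] p by (intro powr_mono2) auto
        moreover have "0 < norm (x - ?R y) powr p"
          using powr_norm_less[OF y] by (meson le_less_trans powr_ge_zero)
        ultimately have "2 * c0 * (v x - u x) / norm (x - ?R y) powr p \<le> b"
          unfolding b_def using nonpos c0
          by (intro divide_left_mono_neg mult_nonneg_nonpos mult_pos_pos)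
            (auto simp: algebra_simps)
        with increment_quotient_pair_le[OF y \<open>y \<noteq> x\<close>] True gy show ?thesis
          by simp
      next
        case False
        have "y \<noteq> ?R x"
          using y xl by (auto simp: reflect_nth)
        from increment_quotient_pair_nonpos[OF \<open>y \<noteq> x\<close> this] False gy show ?thesis
          by simp
      qed
    qed
    ultimately show ?thesis
      by simp
  qed
  have le: "g y + g (?R y) \<le> b * (indicat_real S y + indicat_real S (?R y))" for y
  proof -
    consider "y $ k < l" | "l < y $ k" | "y $ k = l"
      by linarith
    then show ?thesis
    proof cases
      case 1
      then show ?thesis by (rule half)
    next
      case 2
      then have "?R y $ k < l"
        by (simp add: reflect_nth)
      from half[OF this] show ?thesis
        by (simp add: add.commute)
    next
      case 3
      then have eq: "?R y = y"
        by (simp add: reflect_conv_axis)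
      have "y \<notin> ball x \<epsilon>"
        using reflect_notin_ball[of y \<epsilon>] 3 eq \<epsilon> by simp
      then have "g y = h y"
        by (simp add: g_def)
      moreover have "y \<notin> S" "y \<noteq> x"
        using 3 S1(1)[of y] xl by auto
      moreover from this have "y \<noteq> ?R x"
        using eq by (metis reflect_reflect)
      ultimately show ?thesis
        using increment_quotient_pair_nonpos[of y] eq by simp
    qed
  qed
  have g: "integrable lebesgue g"
    using int by (simp add: set_integrable_def g_def[abs_def])
  note gR = integrable_reflect[OF g, of k l]
  have iS: "integrable lebesgue (indicat_real S)"
    unfolding S_def by (intro integrable_real_indicator) (auto simp: emeasure_lborel_ball_finite[unfolded infinity_ennreal_def])
  note iSR = integrable_reflect[OF iS, of k l]
  have "2 * (LINT y|lebesgue. g y) = (LINT y|lebesgue. g y + g (?R y))"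
    using g gR by (simp add: integral_reflect borel_measurable_integrable)
  also have "\<dots> \<le> (LINT y|lebesgue. b * (indicat_real S y + indicat_real S (?R y)))"
    using g gR iS iSR le by (intro integral_mono) auto
  also have "\<dots> = 2 * b * measure lebesgue S"
    using iS iSR by (simp add: integral_reflect borel_measurable_integrable)
  finally have "(LINT y|lebesgue. g y) \<le> b * measure lebesgue S"
    by simp
  moreover have "measure lebesgue S = \<delta> ^ CARD('n) * measure lborel (ball (0 :: real ^ 'n) 1)"
    unfolding S_def using content_ball_conv_unit_ball[of \<delta> "x - (2 * \<delta>) *\<^sub>R axis k 1"] \<open>0 < \<delta>\<close>
    by (subst measure_completion) simp_all
  ultimately show ?thesis
    by (simp add: set_lebesgue_integral_def g_def b_def)
qed

text \<open>The integrals of the nonpositive pair sums over symmetric domains decrease as the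
  domains grow, yet their limit is nonnegative. Hence all of them vanish, and so do the pair sums
  almost everywhere.\<close>

lemma AE_eq_0_if_integral_limit_nonneg:
  assumes x0: "v x = u x"
    and int: "\<And>\<epsilon>. 0 < \<epsilon> \<Longrightarrow> set_integrable lebesgue (- ball x \<epsilon>) h"
    and lim: "((\<lambda>\<epsilon>. LINT z:- ball x \<epsilon>|lebesgue. h z) \<longlongrightarrow> L) (at_right 0)"
    and L: "0 \<le> L"
  shows "AE y in lebesgue. v y = u y"
proof -
  let ?R = "reflect k l"
  define d where "d = l - x $ k"
  have d: "0 < d"
    using xl by (simp add: d_def)
  define B where "B \<epsilon> = {z. ?R z \<in> ball x \<epsilon>}" for \<epsilon>
  define E where "E \<epsilon> = - ball x \<epsilon> - B \<epsilon>" for \<epsilon>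
  \<comment> \<open>The complement of \<open>ball x \<epsilon>\<close> is not symmetric. Its largest symmetric part is \<open>E \<epsilon>\<close>; the
    remainder \<open>B \<epsilon>\<close> contributes nothing in the limit because the integrand is integrable there.\<close>
  define J where "J \<epsilon> = (LINT z:E \<epsilon>|lebesgue. h z)" for \<epsilon>
  \<comment> \<open>A sequence of radii serves both dominated convergence and the countable union of
    null sets. Starting at \<open>d\<close> keeps each ball disjoint from its mirror image.\<close>
  define e where "e n = d * inverse (real (Suc n))" for n
  have e: "0 < e n" "e n \<le> d" for n
    using d by (auto simp: e_def field_simps)
  have e0: "e \<longlonglongrightarrow> 0"
    unfolding e_def using tendsto_mult_right_zero[OF LIMSEQ_inverse_real_of_nat, of d] by simp
  have BB: "B \<epsilon> \<inter> ball x \<epsilon> = {}" if "\<epsilon> \<le> d" for \<epsilon>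
  proof -
    have "z \<notin> ball x \<epsilon>" if "?R z \<in> ball x \<epsilon>" for z
    proof (cases "z $ k \<le> l")
      case True
      then show ?thesis
        using that reflect_notin_ball[of z \<epsilon>] \<open>\<epsilon> \<le> d\<close> by (simp add: d_def)
    next
      case False
      then show ?thesis
        using reflect_notin_ball[of "?R z" \<epsilon>] \<open>\<epsilon> \<le> d\<close> by (simp add: d_def reflect_nth)
    qed
    then show ?thesis
      by (auto simp: B_def)
  qed
  have Bs: "B \<epsilon> \<in> sets lebesgue" for \<epsilon>
    unfolding B_def by (rule sets_lebesgue_reflect) auto
  then have Es: "E \<epsilon> \<in> sets lebesgue" for \<epsilon>
    unfolding E_def by (auto simp: Compl_eq_Diff_UNIV)
  have iE: "set_integrable lebesgue (E \<epsilon>) h" if "0 < \<epsilon>" for \<epsilon>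
    by (rule set_integrable_subset[OF int[OF that] Es]) (auto simp: E_def)
  have iB: "set_integrable lebesgue (B \<epsilon>) h" if "0 < \<epsilon>" "\<epsilon> \<le> d" for \<epsilon>
    by (rule set_integrable_subset[OF int[OF that(1)] Bs]) (use BB[OF that(2)] in auto)
  have split: "(LINT z:- ball x \<epsilon>|lebesgue. h z) = J \<epsilon> + (LINT z:B \<epsilon>|lebesgue. h z)"
    if "0 < \<epsilon>" "\<epsilon> \<le> d" for \<epsilon>
  proof -
    have eq: "- ball x \<epsilon> = E \<epsilon> \<union> B \<epsilon>" and disj: "E \<epsilon> \<inter> B \<epsilon> = {}"
      using BB[OF that(2)] by (auto simp: E_def)
    show ?thesis
      unfolding J_def eq by (rule set_integral_Un[OF disj iE[OF that(1)] iB[OF that]])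
  qed
  have B0: "(\<lambda>n. LINT z:B (e n)|lebesgue. h z) \<longlonglongrightarrow> 0"
  proof -
    let ?s = "\<lambda>n z. indicat_real (B (e n)) z *\<^sub>R h z"
    have "(\<lambda>n. LINT z|lebesgue. ?s n z) \<longlonglongrightarrow> (LINT z|(lebesgue :: (real ^ 'n) measure). 0)"
    \<comment> \<open>Every \<open>B (e n)\<close> lies in \<open>B d\<close>, which misses
      \<open>ball x d\<close>, so \<open>h\<close> off that ball dominates. Each point other than
      the reflection of \<open>x\<close> eventually leaves \<open>B (e n)\<close>.\<close>
    proof (rule integral_dominated_convergence
        [where w = "\<lambda>z. \<bar>indicat_real (- ball x d) z *\<^sub>R h z\<bar>"])
      show "integrable lebesgue (\<lambda>z. \<bar>indicat_real (- ball x d) z *\<^sub>R h z\<bar>)"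
        using int[OF d] by (simp add: set_integrable_def)
      show "?s n \<in> borel_measurable lebesgue" for n
        using iB[OF e] by (auto simp: set_integrable_def)
      show "AE z in lebesgue. norm (?s n z) \<le> \<bar>indicat_real (- ball x d) z *\<^sub>R h z\<bar>" for n
      proof (rule AE_I2)
        fix z
        have "z \<notin> ball x d" if "z \<in> B (e n)"
        proof -
          have "z \<in> B d"
            using that e(2)[of n] by (auto simp: B_def)
          then show ?thesis
            using BB[of d] by auto
        qed
        then show "norm (?s n z) \<le> \<bar>indicat_real (- ball x d) z *\<^sub>R h z\<bar>"
          by (auto simp: indicator_def)
      qed
      have "AE z in lebesgue. z \<noteq> ?R x"
        by (intro AE_completion AE_lborel_singleton)
      then show "AE z in lebesgue. (\<lambda>n. ?s n z) \<longlonglongrightarrow> 0"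
      proof eventually_elim
        case (elim z)
        then have "0 < dist x (?R z)"
          by (metis reflect_reflect zero_less_dist_iff)
        with e0 have "\<forall>\<^sub>F n in sequentially. e n < dist x (?R z)"
          by (rule order_tendstoD)
        then have "\<forall>\<^sub>F n in sequentially. ?s n z = 0"
          by eventually_elim (simp add: B_def)
        then show ?case
          by (rule tendsto_eventually)
      qed
    qed simp
    then show ?thesis
      by (simp add: set_lebesgue_integral_def)
  qed
  have lim_e: "filterlim e (at_right 0) sequentially"
    using e0 e(1) by (simp add: filterlim_at less_imp_neq[THEN not_sym])
  have "(\<lambda>n. J (e n) + (LINT z:B (e n)|lebesgue. h z)) \<longlonglongrightarrow> L"
    using filterlim_compose[OF lim lim_e] split[OF e] by simp
  from tendsto_diff[OF this B0] have J_lim: "(\<lambda>n. J (e n)) \<longlonglongrightarrow> L"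
    by simp
  have notin: "z \<noteq> x" "z \<noteq> ?R x" if "z \<in> E \<epsilon>" "0 < \<epsilon>" for z \<epsilon>
    using that by (auto simp: E_def B_def)
  define q where "q z = h z + h (?R z)" for z
  have ER: "?R z \<in> E \<epsilon> \<longleftrightarrow> z \<in> E \<epsilon>" for z \<epsilon>
    by (auto simp: E_def B_def)
  have iq: "integrable lebesgue (\<lambda>z. indicat_real (E \<epsilon>) z * q z)"
    and J2: "(LINT z|lebesgue. indicat_real (E \<epsilon>) z * q z) = 2 * J \<epsilon>" if "0 < \<epsilon>" for \<epsilon>
  proof -
    define g where "g z = indicat_real (E \<epsilon>) z * h z" for z
    have g: "integrable lebesgue g"
      using iE[OF that] by (simp add: set_integrable_def g_def[abs_def])
    have q: "(\<lambda>z. indicat_real (E \<epsilon>) z * q z) = (\<lambda>z. g z + g (?R z))"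
      by (auto simp: fun_eq_iff g_def q_def ER indicator_def)
    show "integrable lebesgue (\<lambda>z. indicat_real (E \<epsilon>) z * q z)"
      unfolding q using g integrable_reflect[OF g, of k l] by simp
    have "(LINT z|lebesgue. indicat_real (E \<epsilon>) z * q z) = 2 * (LINT z|lebesgue. g z)"
      unfolding q using g integrable_reflect[OF g, of k l]
      by (simp add: integral_reflect borel_measurable_integrable)
    then show "(LINT z|lebesgue. indicat_real (E \<epsilon>) z * q z) = 2 * J \<epsilon>"
      by (simp add: J_def set_lebesgue_integral_def g_def)
  qed
  have q0: "indicat_real (E \<epsilon>) z * q z \<le> 0" if "0 < \<epsilon>" for \<epsilon> z
    using increment_quotient_pair_nonpos[OF notin[OF _ that]] by (auto simp: q_def indicator_def)
  have "AE z in lebesgue. - (indicat_real (E (e m)) z * q z) = 0" for m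
  proof -
    \<comment> \<open>A smaller radius enlarges the domain of a nonpositive integrand.\<close>
    have mono: "J \<epsilon> \<le> J (e m)" if "0 < \<epsilon>" "\<epsilon> \<le> e m" for \<epsilon>
    proof -
      have "E (e m) \<subseteq> E \<epsilon>"
        using that by (auto simp: E_def B_def)
      then have "indicat_real (E \<epsilon>) z * q z \<le> indicat_real (E (e m)) z * q z" for z
        using q0[OF that(1), of z] by (auto simp: indicator_def)
      then have "2 * J \<epsilon> \<le> 2 * J (e m)"
        using that e(1) iq by (subst (1 2) J2[symmetric]) (auto intro!: integral_mono)
      then show ?thesis
        by simp
    qed
    have "\<forall>\<^sub>F n in sequentially. e n < e m"
      using e0 e(1) by (rule order_tendstoD)
    then have "\<forall>\<^sub>F n in sequentially. J (e n) \<le> J (e m)"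
      by eventually_elim (use mono e(1) in auto)
    then have "L \<le> J (e m)"
      by (intro tendsto_upperbound[OF J_lim]) auto
    moreover have "2 * J (e m) \<le> 0"
      using q0[OF e(1)] integral_nonneg_AE[of "\<lambda>z. - (indicat_real (E (e m)) z * q z)" lebesgue]
      by (simp add: J2[OF e(1)])
    ultimately have "(LINT z|lebesgue. - (indicat_real (E (e m)) z * q z)) = 0"
      using L J2[OF e(1)[of m]] by simp
    then show ?thesis
      using iq[OF e(1)] q0[OF e(1)] by (subst (asm) integral_nonneg_eq_0_iff_AE) auto
  qed
  then have "AE z in lebesgue. \<forall>m. - (indicat_real (E (e m)) z * q z) = 0"
    unfolding AE_all_countable by blast
  moreover have "AE z in lebesgue. z \<noteq> x" "AE z in lebesgue. z \<noteq> ?R x"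
    by (intro AE_completion AE_lborel_singleton)+
  ultimately show ?thesis
  proof eventually_elim
    case (elim z)
    \<comment> \<open>The sets \<open>E (e n)\<close> exhaust everything except \<open>x\<close> and
      its reflection.\<close>
    have "0 < min (dist x z) (dist x (?R z))"
      using elim by (auto simp: min_def)
    with e0 have "\<forall>\<^sub>F n in sequentially. e n < min (dist x z) (dist x (?R z))"
      by (rule order_tendstoD)
    then obtain n where "e n < min (dist x z) (dist x (?R z))"
      by (auto dest: eventually_happens)
    then have "z \<in> E (e n)"
      by (auto simp: E_def B_def)
    with elim(1) have "q z = 0"
      by (auto simp: indicator_def split: if_splits)
    then show ?case
      using increment_quotient_pair_eq_0_imp elim x0 by (auto simp: q_def)
  qed
qed

end

section \<open>Difference of the operators and existence of a negative minimum\<close>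

text \<open>Turns the difference of two principal values into the limit of one integral over common
  truncations. Existence of both limits makes \<open>Lim\<close> meaningful, and integrability of
  both integrands allows merging the integrals.\<close>

lemma F_op_diff:
  fixes u v :: "real ^ 'n::finite \<Rightarrow> real"
  assumes "F_defined G \<alpha> u x" "F_defined G \<alpha> v x"
  obtains L where "F_op C G \<alpha> v x - F_op C G \<alpha> u x = C * L"
    and "\<And>\<epsilon>. 0 < \<epsilon> \<Longrightarrow> set_integrable lebesgue (- ball x \<epsilon>) (increment_quotient G (real CARD('n) + \<alpha>) u v x)"
    and "((\<lambda>\<epsilon>. LINT z:- ball x \<epsilon>|lebesgue. increment_quotient G (real CARD('n) + \<alpha>) u v x z)
          \<longlongrightarrow> L) (at_right 0)"
proof -
  let ?h = "increment_quotient G (real CARD('n) + \<alpha>) u v x"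
  let ?f = "\<lambda>u z. G (u x - u z) / norm (x - z) powr (real CARD('n) + \<alpha>)"
  from assms obtain L1 L2 where L: "(F_trunc G \<alpha> v x \<longlongrightarrow> L1) (at_right 0)"
      "(F_trunc G \<alpha> u x \<longlongrightarrow> L2) (at_right 0)"
    unfolding F_defined_def by blast
  have h: "?h = (\<lambda>z. ?f v z - ?f u z)"
    by (simp add: fun_eq_iff increment_quotient_def diff_divide_distrib)
  have int: "set_integrable lebesgue (- ball x \<epsilon>) (?f u)" "set_integrable lebesgue (- ball x \<epsilon>) (?f v)"
    if "0 < \<epsilon>" for \<epsilon>
    using assms that unfolding F_defined_def by blast+
  show thesis
  proof
    show "F_op C G \<alpha> v x - F_op C G \<alpha> u x = C * (L1 - L2)"
      using tendsto_Lim[OF _ L(1)] tendsto_Lim[OF _ L(2)]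
      by (simp add: F_op_def right_diff_distrib)
    show "set_integrable lebesgue (- ball x \<epsilon>) ?h" if "0 < \<epsilon>" for \<epsilon>
      unfolding h using int[OF that] by simp
    have "\<forall>\<^sub>F \<epsilon> in at_right 0. F_trunc G \<alpha> v x \<epsilon> - F_trunc G \<alpha> u x \<epsilon>
        = (LINT z:- ball x \<epsilon>|lebesgue. ?h z)"
      using eventually_at_right_less[of "0::real"]
      by eventually_elim (simp add: F_trunc_def h int)
    with tendsto_diff[OF L]
    show "((\<lambda>\<epsilon>. LINT z:- ball x \<epsilon>|lebesgue. ?h z) \<longlongrightarrow> L1 - L2) (at_right 0)"
      by (rule Lim_transform_eventually)
  qed
qed

text \<open>Treats bounded and unbounded regions at once; for a bounded set the radius is taken so
  large that the claim is vacuous.\<close>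

lemma eventually_gt_if_Liminf_nonneg:
  fixes w :: "'a::real_normed_vector \<Rightarrow> real"
  assumes "bounded S \<or> 0 \<le> Liminf (inf at_infinity (principal S)) (\<lambda>x. ereal (w x))"
    and "m < 0"
  obtains r where "\<And>x. x \<in> S \<Longrightarrow> r \<le> norm x \<Longrightarrow> m < w x"
  using assms(1)
proof
  assume "bounded S"
  then obtain r where r: "\<And>x. x \<in> S \<Longrightarrow> norm x \<le> r"
    by (auto simp: bounded_iff)
  show thesis
    by (rule that[of "r + 1"]) (use r in fastforce)
next
  assume "0 \<le> Liminf (inf at_infinity (principal S)) (\<lambda>x. ereal (w x))"
  then have "\<forall>\<^sub>F x in inf at_infinity (principal S). ereal m < ereal (w x)"
    using \<open>m < 0\<close> unfolding le_Liminf_iff zero_ereal_def by (metis less_ereal.simps(1))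
  then obtain r where "\<And>x. r \<le> norm x \<Longrightarrow> x \<in> S \<Longrightarrow> m < w x"
    by (auto simp: eventually_inf_principal eventually_at_infinity)
  with that show thesis
    by blast
qed

text \<open>The minimum is taken over a compact part of \<open>closure \<Omega>\<close>. Being
  negative, it cannot sit on the plane or in the half space outside \<open>\<Omega>\<close>, where
  \<open>w\<close> is nonnegative.\<close>

lemma negative_min_attained:
  fixes w :: "real ^ 'n::finite \<Rightarrow> real"
  assumes sub: "\<Omega> \<subseteq> half_space k l"
    and lsc: "lsc_on (closure \<Omega>) w"
    and infinity: "bounded \<Omega> \<or> 0 \<le> Liminf (inf at_infinity (principal \<Omega>)) (\<lambda>x. ereal (w x))"
    and outside: "\<And>x. x \<in> half_space k l - \<Omega> \<Longrightarrow> 0 \<le> w x"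
    and plane: "\<And>x. x $ k = l \<Longrightarrow> w x = 0"
    and neg: "a \<in> \<Omega>" "w a < 0"
  obtains x where "x \<in> \<Omega>" "w x < 0" "\<And>y. y $ k < l \<Longrightarrow> w x \<le> w y"
proof -
  \<comment> \<open>The level \<open>w a / 2\<close> lies strictly between \<open>w a\<close> and 0,
    so \<open>a\<close> is inside the ball and points of \<open>\<Omega>\<close> outside it have
    values above the minimum.\<close>
  obtain r where r: "\<And>x. x \<in> \<Omega> \<Longrightarrow> r \<le> norm x \<Longrightarrow> w a / 2 < w x"
    using eventually_gt_if_Liminf_nonneg[OF infinity, of "w a / 2"] neg by auto
  let ?K = "closure \<Omega> \<inter> cball 0 r"
  have "a \<in> ?K"
    using neg r[of a] closure_subset[of \<Omega>] by force
  moreover have "compact ?K"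
    by (simp add: closed_Int_compact)
  ultimately obtain x where x: "x \<in> ?K" "\<And>y. y \<in> ?K \<Longrightarrow> w x \<le> w y"
    using lsc_on_attains_inf[OF lsc, of ?K] by blast
  have wx: "w x \<le> w a"
    using x(2) \<open>a \<in> ?K\<close> by blast
  have "\<Omega> \<subseteq> {y. y $ k \<le> l}"
    using sub by (auto simp: half_space_def)
  moreover have "closed {y :: real ^ 'n. y $ k \<le> l}"
    by (intro closed_Collect_le continuous_intros)
  ultimately have "x $ k \<le> l"
    using closure_minimal[of \<Omega>] x(1) by blast
  then have "x \<in> \<Omega>"
    using outside[of x] plane[of x] wx neg by (fastforce simp: half_space_def)
  moreover have "w x \<le> w y" if "y $ k < l" for y
  proof (cases "y \<in> \<Omega>")
    case True
    show ?thesis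
    proof (cases "y \<in> ?K")
      case True
      then show ?thesis by (rule x(2))
    next
      case False
      with \<open>y \<in> \<Omega>\<close> r[of y] closure_subset[of \<Omega>] wx neg show ?thesis
        by force
    qed
  next
    case False
    with outside[of y] that wx neg show ?thesis
      by (force simp: half_space_def)
  qed
  moreover have "w x < 0"
    using wx neg by linarith
  ultimately show thesis
    using that by blast
qed

lemma C11_loc_isCont:
  assumes "w \<in> C11_loc S" "x \<in> S"
  shows "isCont w x"
  using assms has_derivative_continuous unfolding C11_loc_def gderiv_def by blast

section \<open>Choice of the strip width, and both conclusions\<close>

theorem theorem3:
  fixes k :: "'n::finite" and \<alpha> C c0 l K :: real and G :: "real \<Rightarrow> real"
  assumes "0 < \<alpha>" and "\<alpha> < 2"
    and "0 < C"
    and "G C1_differentiable_on UNIV" and "G 0 = 0"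
    and "0 < c0" and "\<And>t. c0 \<le> deriv G t"
    and "0 \<le> K"
  shows "\<exists>\<delta>0>0. \<forall>\<delta>. 0 < \<delta> \<and> \<delta> \<le> \<delta>0 \<longrightarrow>
    (\<forall>(\<Omega> :: (real ^ 'n) set) (c :: real ^ 'n \<Rightarrow> real) (u :: real ^ 'n \<Rightarrow> real)
        (ul :: real ^ 'n \<Rightarrow> real) (w :: real ^ 'n \<Rightarrow> real).
      open \<Omega> \<and> \<Omega> \<subseteq> half_space k l \<and> \<Omega> \<subseteq> {x. l - \<delta> < x $ k \<and> x $ k < l} \<and>
      (\<forall>x\<in>\<Omega>. - K \<le> c x) \<and>
      ul = (\<lambda>x. u (reflect k l x)) \<and> w = (\<lambda>x. ul x - u x) \<and>
      u \<in> L_space \<alpha> \<and>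
      (\<forall>x\<in>\<Omega>. F_defined G \<alpha> u x \<and> F_defined G \<alpha> ul x) \<and>
      w \<in> L_space \<alpha> \<and> w \<in> C11_loc \<Omega> \<and> lsc_on (closure \<Omega>) w \<and>
      (\<forall>x\<in>\<Omega>. 0 \<le> F_op C G \<alpha> ul x - F_op C G \<alpha> u x + c x * w x) \<and>
      (\<forall>x \<in> half_space k l - \<Omega>. 0 \<le> w x) \<and>
      (\<forall>x \<in> half_space k l. w (reflect k l x) = - w x) \<and>
      (bounded \<Omega> \<or> 0 \<le> Liminf (inf at_infinity (principal \<Omega>)) (\<lambda>x. ereal (w x)))
      \<longrightarrow>
      (\<forall>x\<in>\<Omega>. 0 \<le> w x) \<and>
      ((\<exists>x\<in>\<Omega>. w x = 0) \<longrightarrow> (AE x in lebesgue. w x = 0)))"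
proof -
  define p where "p = real CARD('n) + \<alpha>"
  define V where "V = measure lborel (ball (0 :: real ^ 'n) 1)"
  \<comment> \<open>Multiplied by \<open>C\<close>, the integral bound becomes
    \<open>2 * w x * (A / \<delta> powr \<alpha>)\<close>, as the volume factor cancels the power n
    of the kernel. The width \<open>\<delta>0\<close> solves
    \<open>A / \<delta>0 powr \<alpha> = K + 1\<close>; the added 1 keeps the denominator positive
    when \<open>K = 0\<close>.\<close>
  define A where "A = C * c0 * V / 5 powr p"
  define \<delta>0 where "\<delta>0 = (A / (K + 1)) powr (1 / \<alpha>)"
  have p: "0 < p"
    using \<open>0 < \<alpha>\<close> by (simp add: p_def add_nonneg_pos)
  have V: "0 < V"
    unfolding V_def by (rule content_ball_pos) simp
  have A: "0 < A"
    using V \<open>0 < C\<close> \<open>0 < c0\<close> by (simp add: A_def)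
  note G = mean_value_lower[OF assms(4,7)]
  have "0 < \<delta>0"
    using A \<open>0 \<le> K\<close> by (simp add: \<delta>0_def)
  show ?thesis
  proof (intro exI[of _ \<delta>0] conjI[OF \<open>0 < \<delta>0\<close>] allI impI, goal_cases)
    case (1 \<delta> \<Omega> c u ul w)
    then have \<delta>: "0 < \<delta>" "\<delta> \<le> \<delta>0"
      and sub: "\<Omega> \<subseteq> half_space k l"
      and strip: "\<And>x. x \<in> \<Omega> \<Longrightarrow> l - \<delta> < x $ k \<and> x $ k < l"
      and c: "\<And>x. x \<in> \<Omega> \<Longrightarrow> - K \<le> c x"
      and ul: "ul = (\<lambda>x. u (reflect k l x))" and w: "w = (\<lambda>x. ul x - u x)"
      and F: "\<And>x. x \<in> \<Omega> \<Longrightarrow> F_defined G \<alpha> u x" "\<And>x. x \<in> \<Omega> \<Longrightarrow> F_defined G \<alpha> ul x"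
      and C11: "w \<in> C11_loc \<Omega>" and lsc: "lsc_on (closure \<Omega>) w"
      and ineq: "\<And>x. x \<in> \<Omega> \<Longrightarrow> 0 \<le> F_op C G \<alpha> ul x - F_op C G \<alpha> u x + c x * w x"
      and outside: "\<And>x. x \<in> half_space k l - \<Omega> \<Longrightarrow> 0 \<le> w x"
      and infinity: "bounded \<Omega> \<or> 0 \<le> Liminf (inf at_infinity (principal \<Omega>)) (\<lambda>x. ereal (w x))"
      by auto
    have plane: "w x = 0" if "x $ k = l" for x
      using that by (simp add: w ul reflect_conv_axis)
    have nonneg: "0 \<le> w a" if "a \<in> \<Omega>" for a
    proof (rule ccontr)
      assume "\<not> 0 \<le> w a"
      then have "w a < 0"
        by simp
      then obtain x where x: "x \<in> \<Omega>" "w x < 0" and min: "\<And>y. y $ k < l \<Longrightarrow> w x \<le> w y"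
        using negative_min_attained[OF sub lsc infinity outside plane \<open>a \<in> \<Omega>\<close>] by blast
      obtain L where L: "F_op C G \<alpha> ul x - F_op C G \<alpha> u x = C * L"
        and int: "\<And>\<epsilon>. 0 < \<epsilon> \<Longrightarrow> set_integrable lebesgue (- ball x \<epsilon>) (increment_quotient G p u ul x)"
        and lim: "((\<lambda>\<epsilon>. LINT z:- ball x \<epsilon>|lebesgue. increment_quotient G p u ul x z) \<longlongrightarrow> L) (at_right 0)"
        by (rule F_op_diff[OF F[OF x(1)], where C = C, folded p_def]) (rule that)
      define b where "b = 2 * c0 * w x / (5 * \<delta>) powr p * (\<delta> ^ CARD('n) * V)"
      \<comment> \<open>Negativity of \<open>w\<close> near \<open>x\<close> controls the unpaired
        reflections of points in the removed ball.\<close>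
      have "\<forall>\<^sub>F y in nhds x. w y < 0"
        using C11_loc_isCont[OF C11 x(1)] x(2)
        unfolding isCont_def tendsto_at_iff_tendsto_nhds by (rule order_tendstoD)
      then obtain \<epsilon>1 where \<epsilon>1: "0 < \<epsilon>1" "\<And>y. y \<in> ball x \<epsilon>1 \<Longrightarrow> w y < 0"
        by (auto simp: eventually_nhds_metric dist_commute)
      have bound: "(LINT z:- ball x \<epsilon>|lebesgue. increment_quotient G p u ul x z) \<le> b"
        if "0 < \<epsilon>" "\<epsilon> < min \<epsilon>1 (l - x $ k)" for \<epsilon>
      proof -
        have "ul x - u x + (ul y - u y) \<le> 0" if "y \<in> ball x \<epsilon>" for y
          using \<epsilon>1(2)[of y] x(2) that \<open>\<epsilon> < min \<epsilon>1 (l - x $ k)\<close> by (simp add: w)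
        then show ?thesis
          using integral_increment_quotient_le
            [OF G \<open>0 < c0\<close> p ul _ _ _ _ that(1) _ _ int[OF that(1)], of \<delta>]
            min strip[OF x(1)] x(2) that(2)
          by (simp add: w b_def V_def)
      qed
      have "0 < min \<epsilon>1 (l - x $ k)"
        using \<epsilon>1 strip[OF x(1)] by simp
      then have "\<forall>\<^sub>F \<epsilon> in at_right 0. (LINT z:- ball x \<epsilon>|lebesgue. increment_quotient G p u ul x z) \<le> b"
        unfolding eventually_at_right_field using bound by blast
      then have "L \<le> b"
        by (intro tendsto_upperbound[OF lim]) auto
      moreover have "C * b \<le> 2 * (K + 1) * w x"
      proof -
        have "\<delta> powr \<alpha> \<le> \<delta>0 powr \<alpha>"
          using \<delta> \<open>0 < \<alpha>\<close> by (intro powr_mono2) auto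
        also have "\<dots> = A / (K + 1)"
          using \<open>0 < \<alpha>\<close> A \<open>0 \<le> K\<close> by (simp add: \<delta>0_def powr_powr)
        finally have "K + 1 \<le> A / \<delta> powr \<alpha>"
          using \<delta> \<open>0 \<le> K\<close> by (simp add: field_simps)
        moreover have "C * b = 2 * w x * (A / \<delta> powr \<alpha>)"
          using \<delta> by (simp add: b_def A_def p_def powr_mult powr_add powr_realpow field_simps)
        ultimately show ?thesis
          using mult_left_mono_neg[of "K + 1" "A / \<delta> powr \<alpha>" "2 * w x"] x(2)
          by (simp add: mult_ac)
      qed
      ultimately have "C * L \<le> 2 * (K + 1) * w x"
        using mult_left_mono[of L b C] \<open>0 < C\<close> by linarith
      moreover have "c x * w x \<le> - K * w x"
        using c[OF x(1)] x(2) by (intro mult_right_mono_neg) auto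
      \<comment> \<open>The two bounds add up to \<open>2 * (K + 1) * w x - K * w x\<close>, which
        is this negative number, against the assumed inequality at \<open>x\<close>.\<close>
      moreover have "(K + 2) * w x < 0"
        using x(2) \<open>0 \<le> K\<close> by (simp add: mult_pos_neg)
      ultimately show False
        using ineq[OF x(1)] L by (simp add: algebra_simps)
    qed
    moreover have "AE y in lebesgue. w y = 0" if x: "x \<in> \<Omega>" "w x = 0" for x
    proof -
      obtain L where L: "F_op C G \<alpha> ul x - F_op C G \<alpha> u x = C * L"
        and int: "\<And>\<epsilon>. 0 < \<epsilon> \<Longrightarrow> set_integrable lebesgue (- ball x \<epsilon>) (increment_quotient G p u ul x)"
        and lim: "((\<lambda>\<epsilon>. LINT z:- ball x \<epsilon>|lebesgue. increment_quotient G p u ul x z) \<longlongrightarrow> L) (at_right 0)"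
        by (rule F_op_diff[OF F[OF x(1)], where C = C, folded p_def]) (rule that)
      \<comment> \<open>At a zero of \<open>w\<close> the term with \<open>c\<close> drops out.
        Nonnegativity of \<open>w\<close> on the half space, now known, makes \<open>x\<close> a
        minimum point.\<close>
      have "0 \<le> L"
        using ineq[OF x(1)] x(2) L \<open>0 < C\<close> by (simp add: zero_le_mult_iff)
      moreover have "ul x - u x \<le> ul y - u y" if "y $ k < l" for y
        using x(2) that nonneg[of y] outside[of y] by (auto simp: w half_space_def)
      ultimately have "AE y in lebesgue. ul y = u y"
        using AE_eq_0_if_integral_limit_nonneg[OF G \<open>0 < c0\<close> p ul _ _ _ _ int lim]
          strip[OF x(1)] x(2) by (simp add: w)
      then show ?thesis
        by (simp add: w)
    qed
    ultimately show ?case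
      by blast
  qed
qed

end
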